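(* Let $\mu\ge\mu_{\min}$, where $\mu_{\min}=2+\omega+\omega^{-1}\approx4.38$ with $\omega=\frac13\left(\sqrt[3]{19+3\sqrt{33}}+\sqrt[3]{19-3\sqrt{33}}+1\right)$. Let $G_k=G_k(\mathbb T,C)$, $k\ge1$, be a generalized Shearer sequence which is dominated by $\mu$, i.e. $\lim_{k\to\infty}\rho_L(G_k)\le\mu$. For $k\ge2$ let $\varepsilon_k$ be the smallest positive solution $\varepsilon$ of $S_k(\varepsilon)=0$, where $(S_1(\varepsilon),\dots,S_k(\varepsilon))=\Pi(G_k,\mu-\varepsilon)$. Then $$\lim_{k\to\infty}\rho_L(G_k)=\mu\quad\Longleftrightarrow\quad\lim_{k\to\infty}\varepsilon_k=0.$$
   Context: For a finite graph $G$, $\rho_L(G)$ is the largest eigenvalue of the Laplacian matrix $L(G)=D(G)-A(G)$. A starlike tree is encoded as $T=[q_1,\dots,q_r]$ with positive integers $q_1\le\dots\le q_r$, or $T=[0]$ (empty); its width is $r$ (and $0$ for $[0]$). The linear tree $[T_1,\dots,T_k]$ is obtained from a path $v_1v_2\cdots v_k$ by attaching at each $v_j$, for $T_j=[q_1,\dots,q_r]$, $r$ disjoint pendant paths with $q_1,\dots,q_r$ vertices respectively (an end vertex of each is joined to $v_j$ by an edge); if $T_j=[0]$ nothing is attached. Generalized Shearer sequence: given sequences of starlike trees $\mathbb T=(T_1,T_2,\dots)$ and $C=(C_2,C_3,\dots)$, each with widths bounded by a constant, put $G_1=[T_1]$ and $G_k(\mathbb T,C)=[T_1,\dots,T_{k-1},C_k]$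 for $k\ge2$; this is a generalized Shearer sequence if $\rho_L(G_k)<\rho_L(G_{k+1})$ for all $k\ge1$ (the limit of $\rho_L(G_k)$ then exists). Drift: for a real number $\nu$ put $b_1=1-\nu$, $b_{i+1}=2-\nu-\frac1{b_i}$, and $\delta([q_1,\dots,q_r],\nu)=\sum_{i=1}^r\left(1-\frac1{b_{q_i}}\right)$, $\delta([0],\nu)=0$. $\Pi(G_k,\mu-\varepsilon)$: with $\mu_\varepsilon=\mu-\varepsilon$ and $\psi_\varepsilon(t)=2-\mu_\varepsilon-\frac1t$, $S_1(\varepsilon)=1-\mu_\varepsilon+\delta(T_1,\mu_\varepsilon)$; $S_j(\varepsilon)=\psi_\varepsilon(S_{j-1}(\varepsilon))+\delta(T_j,\mu_\varepsilon)$ for $2\le j\le k-1$; $S_k(\varepsilon)=-1+\psi_\varepsilon(S_{k-1}(\varepsilon))+\delta(C_k,\mu_\varepsilon)$. These are regarded as rational functions of $\varepsilon$. *)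

theory Defs
  imports
    "Graph_Theory.Pair_Digraph"
    "Jordan_Normal_Form.Spectral_Radius"
    "HOL-Computational_Algebra.Fraction_Field"
    "HOL-Library.Countable_Set"
    Complex_Main
begin

section \<open>Largest Laplacian eigenvalue of a finite graph\<close>

text \<open>
  A finite simple graph is a \<^locale>\<open>pair_graph\<close>: each edge \<open>{u, v}\<close> is represented by the two arcs
  \<open>(u, v)\<close> and \<open>(v, u)\<close>, so the degree of a vertex is its out-degree.  The vertices are enumerated
  by \<^const>\<open>from_nat_into\<close>, which for finite \<open>V\<close> is a bijection from \<open>{..<card V}\<close> onto \<open>V\<close>;
  another enumeration gives a matrix similar by a permutation.
\<close>

definition adjacency_matrix :: "'a pair_pre_digraph \<Rightarrow> real mat" where
  "adjacency_matrix G =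
     (let n = card (pverts G); vtx = from_nat_into (pverts G)
      in mat n n (\<lambda>(i, j). if (vtx i, vtx j) \<in> parcs G then 1 else 0))"

definition degree_matrix :: "'a pair_pre_digraph \<Rightarrow> real mat" where
  "degree_matrix G =
     (let n = card (pverts G); vtx = from_nat_into (pverts G)
      in mat n n (\<lambda>(i, j). if i = j then real (out_degree (with_proj G) (vtx i)) else 0))"

definition laplacian :: "'a pair_pre_digraph \<Rightarrow> real mat" where
  "laplacian G = degree_matrix G - adjacency_matrix G"

text \<open>
  The Laplacian is symmetric, so all its eigenvalues are real.  If \<open>G\<close> has a vertex, then
  the set below is finite and nonempty (\<open>0\<close> is an eigenvalue).
\<close>

definition rho_L :: "'a pair_pre_digraph \<Rightarrow> real" where
  "rho_L G = Max (spectrum (laplacian G))"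

section \<open>Starlike trees and linear trees\<close>

definition starlike_tree :: "nat list \<Rightarrow> bool" where
  "starlike_tree T \<longleftrightarrow> T = [0] \<or> (T \<noteq> [] \<and> sorted T \<and> (\<forall>q \<in> set T. 0 < q))"

definition legs :: "nat list \<Rightarrow> nat list" where
  "legs T = (if T = [0] then [] else T)"

definition width :: "nat list \<Rightarrow> nat" where
  "width T = length (legs T)"

text \<open>
  All indices are 0-based: \<open>Spine j\<close> is the vertex of the path carrying \<open>Ts ! j\<close>, and
  \<open>Pendant j i p\<close> is the vertex at distance \<open>p + 1\<close> from \<open>Spine j\<close> on the \<open>i\<close>-th pendant path
  attached there.
\<close>

datatype lt_vertex = Spine nat | Pendant nat nat nat

instance lt_vertex :: countable
  by countable_datatype

definition lt_verts :: "nat list list \<Rightarrow> lt_vertex set" where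
  "lt_verts Ts =
     {Spine j | j. j < length Ts} \<union>
     {Pendant j i p | j i p.
        j < length Ts \<and> i < length (legs (Ts ! j)) \<and> p < legs (Ts ! j) ! i}"

definition lt_arcs :: "nat list list \<Rightarrow> lt_vertex rel" where
  "lt_arcs Ts =
     {(Spine j, Spine (Suc j)) | j. Spine (Suc j) \<in> lt_verts Ts} \<union>
     {(Spine j, Pendant j i 0) | j i. Pendant j i 0 \<in> lt_verts Ts} \<union>
     {(Pendant j i p, Pendant j i (Suc p)) | j i p. Pendant j i (Suc p) \<in> lt_verts Ts}"

definition linear_tree :: "nat list list \<Rightarrow> lt_vertex pair_pre_digraph" where
  "linear_tree Ts = \<lparr> pverts = lt_verts Ts, parcs = symcl (lt_arcs Ts) \<rparr>"

lemma finite_lt_verts: "finite (lt_verts Ts)"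
proof -
  have "lt_verts Ts \<subseteq> Spine ` {..<length Ts} \<union>
     (\<Union>j<length Ts. \<Union>i<length (legs (Ts ! j)). Pendant j i ` {..<legs (Ts ! j) ! i})"
    by (auto simp: lt_verts_def)
  then show ?thesis
    by (rule finite_subset) auto
qed

lemma pair_graph_linear_tree: "pair_graph (linear_tree Ts)"
proof -
  have V: "symcl (lt_arcs Ts) \<subseteq> lt_verts Ts \<times> lt_verts Ts"
    by (auto simp: symcl_def lt_arcs_def lt_verts_def)
  then have "finite (symcl (lt_arcs Ts))"
    by (rule finite_subset) (simp add: finite_lt_verts)
  moreover have "sym (symcl (lt_arcs Ts))"
    by (auto simp: sym_def symcl_def)
  moreover have "fst e \<noteq> snd e" if "e \<in> symcl (lt_arcs Ts)" for e
    using that by (auto simp: symcl_def lt_arcs_def)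
  ultimately show ?thesis
    using V by unfold_locales
      (auto simp: linear_tree_def finite_lt_verts symmetric_def)
qed

section \<open>Generalized Shearer sequences\<close>

text \<open>
  The sequences are indexed as \<open>T 1, T 2, \<dots>\<close> and \<open>C 2, C 3, \<dots>\<close>; the values \<open>T 0\<close>, \<open>C 0\<close> and \<open>C 1\<close>
  play no role (in particular \<open>shearer_graph T C 0\<close> is irrelevant).
\<close>

definition shearer_graph :: "(nat \<Rightarrow> nat list) \<Rightarrow> (nat \<Rightarrow> nat list) \<Rightarrow> nat \<Rightarrow> lt_vertex pair_pre_digraph"
  where
  "shearer_graph T C k =
     (if k = 1 then linear_tree [T 1] else linear_tree (map T [1..<k] @ [C k]))"

definition generalized_shearer :: "(nat \<Rightarrow> nat list) \<Rightarrow> (nat \<Rightarrow> nat list) \<Rightarrow> bool" where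
  "generalized_shearer T C \<longleftrightarrow>
     (\<forall>j\<ge>1. starlike_tree (T j)) \<and> (\<forall>j\<ge>2. starlike_tree (C j)) \<and>
     (\<exists>B. (\<forall>j\<ge>1. width (T j) \<le> B) \<and> (\<forall>j\<ge>2. width (C j) \<le> B)) \<and>
     (\<forall>k\<ge>1. rho_L (shearer_graph T C k) < rho_L (shearer_graph T C (Suc k)))"

definition dominated_by :: "(nat \<Rightarrow> nat list) \<Rightarrow> (nat \<Rightarrow> nat list) \<Rightarrow> real \<Rightarrow> bool" where
  "dominated_by T C \<mu> \<longleftrightarrow> lim (\<lambda>k. rho_L (shearer_graph T C k)) \<le> \<mu>"

section \<open>Drift and the sequence \<open>S\<^sub>1, \<dots>, S\<^sub>k\<close>\<close>

text \<open>
  The formulas are stated over an arbitrary field, so that they can be used both for a real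
  number \<open>\<nu>\<close> and for the rational function \<open>\<mu> - \<epsilon>\<close> in \<open>\<epsilon>\<close>.  The value \<open>path_b \<nu> 0\<close> is a dummy.
\<close>

fun path_b :: "'a :: field \<Rightarrow> nat \<Rightarrow> 'a" where
  "path_b \<nu> 0 = 0"
| "path_b \<nu> (Suc 0) = 1 - \<nu>"
| "path_b \<nu> (Suc (Suc i)) = 2 - \<nu> - 1 / path_b \<nu> (Suc i)"

definition drift :: "nat list \<Rightarrow> 'a :: field \<Rightarrow> 'a" where
  "drift T \<nu> = (\<Sum>q \<leftarrow> legs T. 1 - 1 / path_b \<nu> q)"

definition psi :: "'a :: field \<Rightarrow> 'a \<Rightarrow> 'a" where
  "psi \<nu> t = 2 - \<nu> - 1 / t"

text \<open>
  \<open>S_inner\<close> gives the entries \<open>S\<^sub>j\<close> with \<open>1 \<le> j \<le> k - 1\<close>, which do not depend on \<open>k\<close>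
  (\<open>S_inner T \<nu> 0\<close> is a dummy); \<open>S_last\<close> gives \<open>S\<^sub>k\<close> for \<open>k \<ge> 2\<close>.
\<close>

fun S_inner :: "(nat \<Rightarrow> nat list) \<Rightarrow> 'a :: field \<Rightarrow> nat \<Rightarrow> 'a" where
  "S_inner T \<nu> 0 = 0"
| "S_inner T \<nu> (Suc 0) = 1 - \<nu> + drift (T 1) \<nu>"
| "S_inner T \<nu> (Suc (Suc j)) = psi \<nu> (S_inner T \<nu> (Suc j)) + drift (T (Suc (Suc j))) \<nu>"

definition S_last :: "(nat \<Rightarrow> nat list) \<Rightarrow> (nat \<Rightarrow> nat list) \<Rightarrow> 'a :: field \<Rightarrow> nat \<Rightarrow> 'a" where
  "S_last T C \<nu> k = - 1 + psi \<nu> (S_inner T \<nu> (k - 1)) + drift (C k) \<nu>"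

text \<open>
  \<open>S\<^sub>k\<close> as a rational function of \<open>\<epsilon>\<close>, i.e. as an element of the field of fractions of the
  polynomial ring in \<open>\<epsilon>\<close>; \<^term>\<open>[:\<mu>, - 1:]\<close> is the polynomial \<open>\<mu> - \<epsilon>\<close>.
\<close>

definition S_rat :: "(nat \<Rightarrow> nat list) \<Rightarrow> (nat \<Rightarrow> nat list) \<Rightarrow> real \<Rightarrow> nat \<Rightarrow> real poly fract" where
  "S_rat T C \<mu> k = S_last T C (Fract [:\<mu>, - 1:] 1) k"

text \<open>
  \<open>x\<close> is a zero of the rational function \<open>f\<close>: some representation of \<open>f\<close> as a quotient
  is defined at \<open>x\<close> and vanishes there.
\<close>

definition rat_zero :: "real poly fract \<Rightarrow> real \<Rightarrow> bool" where
  "rat_zero f x \<longleftrightarrow> (\<exists>p q. f = Fract p q \<and> poly q x \<noteq> 0 \<and> poly p x = 0)"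

definition eps :: "(nat \<Rightarrow> nat list) \<Rightarrow> (nat \<Rightarrow> nat list) \<Rightarrow> real \<Rightarrow> nat \<Rightarrow> real" where
  "eps T C \<mu> k = (LEAST \<epsilon>. 0 < \<epsilon> \<and> rat_zero (S_rat T C \<mu> k) \<epsilon>)"

section \<open>The constant \<open>\<mu>\<^sub>m\<^sub>i\<^sub>n\<close>\<close>

definition omega :: real where
  "omega = 1 / 3 * (root 3 (19 + 3 * sqrt 33) + root 3 (19 - 3 * sqrt 33) + 1)"

definition mu_min :: real where
  "mu_min = 2 + omega + inverse omega"

end

theory Submission
  imports Defs
begin

text \<open>
  For \<open>k \<ge> 2\<close> one has \<open>\<epsilon>\<^sub>k = \<mu> - \<rho>\<^sub>L(G\<^sub>k)\<close>.  The entries of \<open>\<Pi>(G\<^sub>k, \<nu>)\<close> are the pivots of an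
  elimination of \<open>L - \<nu> I\<close> from the leaves to the last spine vertex.  There is a largest \<open>\<nu>\<^sup>*\<close> with
  \<open>S\<^sub>k = 0\<close>; above it all pivots are negative, and at \<open>\<nu>\<^sup>*\<close> all the others still are, so back
  substitution yields an eigenfunction of alternating sign whose absolute value is positive.  Such
  an eigenfunction belongs to the largest eigenvalue, hence \<open>\<nu>\<^sup>* = \<rho>\<^sub>L(G\<^sub>k)\<close>.  Bounded widths make
  \<open>\<rho>\<^sub>L(G\<^sub>k)\<close> bounded, so the strictly increasing sequence converges and stays below \<open>\<mu>\<close>.
\<close>

section \<open>Eigenvalues of the Laplacian as eigenvalues of a difference operator\<close>

lemma laplacian_carrier: "laplacian G \<in> carrier_mat (card (pverts G)) (card (pverts G))"
  unfolding laplacian_def adjacency_matrix_def Let_def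
  by (intro minus_carrier_mat mat_carrier)

text \<open>Row \<open>i\<close> holds the degree on the diagonal and -1 at each neighbour;
  distributing the degree over the neighbours gives a sum of differences.\<close>

lemma laplacian_mult_vec:
  fixes f :: "'a \<Rightarrow> real"
  assumes "pair_graph G" and i: "i < card (pverts G)"
  defines "vtx \<equiv> from_nat_into (pverts G)"
  shows "(laplacian G *\<^sub>v vec (card (pverts G)) (\<lambda>j. f (vtx j))) $ i =
    (\<Sum>u | (vtx i, u) \<in> parcs G. f (vtx i) - f u)"
proof -
  interpret pair_graph G by fact
  let ?n = "card (pverts G)"
  define N where "N = {u. (vtx i, u) \<in> parcs G}"
  have bij: "bij_betw vtx {..<?n} (pverts G)"
    unfolding vtx_def by (rule bij_betw_from_nat_into_finite) simp
  have N: "N \<subseteq> pverts G"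
    by (auto simp: N_def dest: in_arcsD2)
  have "out_arcs (with_proj G) (vtx i) = Pair (vtx i) ` N"
    by (auto simp: out_arcs_def N_def)
  then have deg: "out_degree (with_proj G) (vtx i) = card N"
    by (simp add: out_degree_def card_image inj_on_def)
  have entry: "laplacian G $$ (i, j) =
      (if i = j then real (card N) else 0) - (if (vtx i, vtx j) \<in> parcs G then 1 else 0)"
    if "j < ?n" for j
    using i that deg
    unfolding laplacian_def degree_matrix_def adjacency_matrix_def Let_def vtx_def[symmetric]
    by auto
  have "(laplacian G *\<^sub>v vec ?n (\<lambda>j. f (vtx j))) $ i =
      (\<Sum>j<?n. laplacian G $$ (i, j) * f (vtx j))"
    using i laplacian_carrier[of G] by (simp add: scalar_prod_def atLeast0LessThan)
  also have "\<dots> = (\<Sum>j<?n. ((if i = j then real (card N) else 0) -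
        (if (vtx i, vtx j) \<in> parcs G then 1 else 0)) * f (vtx j))"
    by (intro sum.cong) (simp_all add: entry)
  also have "\<dots> = real (card N) * f (vtx i) -
      (\<Sum>j<?n. if (vtx i, vtx j) \<in> parcs G then f (vtx j) else 0)"
  proof -
    have "((if i = j then real (card N) else 0) -
        (if (vtx i, vtx j) \<in> parcs G then 1 else 0)) * f (vtx j) =
      (if i = j then real (card N) * f (vtx i) else 0) -
        (if (vtx i, vtx j) \<in> parcs G then f (vtx j) else 0)" for j
      by (simp add: left_diff_distrib)
    then show ?thesis
      using i by (simp add: sum_subtractf)
  qed
  also have "(\<Sum>j<?n. if (vtx i, vtx j) \<in> parcs G then f (vtx j) else 0) =
      (\<Sum>u\<in>pverts G. if (vtx i, u) \<in> parcs G then f u else 0)"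
    by (rule sum.reindex_bij_betw[OF bij])
  also have "\<dots> = (\<Sum>u\<in>N. f u)"
    using N by (intro sum.mono_neutral_cong_right) (auto simp: N_def)
  finally show ?thesis
    by (simp add: N_def sum_subtractf)
qed

text \<open>Vectors and functions on the vertices correspond under the enumeration, so later
  arguments can work with vertices instead of matrix indices.\<close>

lemma eigenvalue_laplacian_iff:
  assumes G: "pair_graph G"
  shows "eigenvalue (laplacian G) \<kappa> \<longleftrightarrow>
    (\<exists>f. (\<exists>v\<in>pverts G. f v \<noteq> 0) \<and>
      (\<forall>v\<in>pverts G. (\<Sum>u | (v, u) \<in> parcs G. f v - f u) = \<kappa> * f v))"
proof -
  interpret pair_graph G by fact
  define n where "n = card (pverts G)"
  define vtx where "vtx = from_nat_into (pverts G)"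
  have bij: "bij_betw vtx {..<n} (pverts G)"
    unfolding vtx_def n_def by (rule bij_betw_from_nat_into_finite) simp
  have dim: "dim_row (laplacian G) = n"
    using laplacian_carrier[of G] by (simp add: n_def)
  have eigenvector_iff: "eigenvector (laplacian G) (vec n (\<lambda>j. f (vtx j))) \<kappa> \<longleftrightarrow>
      (\<exists>v\<in>pverts G. f v \<noteq> 0) \<and>
      (\<forall>v\<in>pverts G. (\<Sum>u | (v, u) \<in> parcs G. f v - f u) = \<kappa> * f v)" for f
  proof -
    have "vec n (\<lambda>j. f (vtx j)) \<noteq> 0\<^sub>v n \<longleftrightarrow> (\<exists>i<n. f (vtx i) \<noteq> 0)"
      by (auto simp: vec_eq_iff)
    also have "\<dots> \<longleftrightarrow> (\<exists>v\<in>pverts G. f v \<noteq> 0)"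
      unfolding bij_betw_imp_surj_on[OF bij, symmetric] by auto
    moreover have "laplacian G *\<^sub>v vec n (\<lambda>j. f (vtx j)) = \<kappa> \<cdot>\<^sub>v vec n (\<lambda>j. f (vtx j)) \<longleftrightarrow>
        (\<forall>i<n. (\<Sum>u | (vtx i, u) \<in> parcs G. f (vtx i) - f u) = \<kappa> * f (vtx i))"
      using laplacian_mult_vec[OF G, of _ f, folded vtx_def n_def]
      by (auto simp: vec_eq_iff dim simp del: index_mult_mat_vec)
    moreover have "\<dots> \<longleftrightarrow>
        (\<forall>v\<in>pverts G. (\<Sum>u | (v, u) \<in> parcs G. f v - f u) = \<kappa> * f v)"
      unfolding bij_betw_imp_surj_on[OF bij, symmetric] by auto
    ultimately show ?thesis
      by (simp add: eigenvector_def dim)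
  qed
  show ?thesis
  proof
    assume "eigenvalue (laplacian G) \<kappa>"
    then obtain w where w: "eigenvector (laplacian G) w \<kappa>"
      unfolding eigenvalue_def by blast
    define f where "f u = w $ inv_into {..<n} vtx u" for u
    have "w = vec n (\<lambda>j. f (vtx j))"
      using w bij by (auto simp: eigenvector_def dim f_def bij_betw_def vec_eq_iff)
    with w eigenvector_iff show "\<exists>f. (\<exists>v\<in>pverts G. f v \<noteq> 0) \<and>
        (\<forall>v\<in>pverts G. (\<Sum>u | (v, u) \<in> parcs G. f v - f u) = \<kappa> * f v)"
      by metis
  qed (use eigenvector_iff in \<open>auto simp: eigenvalue_def\<close>)
qed

text \<open>
  The hypothesis says that \<open>y\<close> is a positive supersolution for the signless Laplacian; comparing
  \<open>\<bar>g\<bar>\<close> for an eigenfunction \<open>g\<close> with \<open>y\<close> at a vertex where \<open>\<bar>g\<bar> / y\<close> is maximal replaces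
  Perron--Frobenius.
\<close>

lemma eigenvalue_laplacian_le:
  fixes y :: "'a \<Rightarrow> real"
  assumes G: "pair_graph G" and \<kappa>: "eigenvalue (laplacian G) \<kappa>"
    and y: "\<And>v. v \<in> pverts G \<Longrightarrow> 0 < y v"
    and le: "\<And>v. v \<in> pverts G \<Longrightarrow> (\<Sum>u | (v, u) \<in> parcs G. y v + y u) \<le> M * y v"
  shows "\<kappa> \<le> M"
proof -
  interpret pair_graph G by fact
  obtain g w where w: "w \<in> pverts G" "g w \<noteq> 0"
    and g: "\<And>v. v \<in> pverts G \<Longrightarrow> (\<Sum>u | (v, u) \<in> parcs G. g v - g u) = \<kappa> * g v"
    using \<kappa> unfolding eigenvalue_laplacian_iff[OF G] by blast
  define R where "R = (\<lambda>v. \<bar>g v\<bar> / y v) ` pverts G"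
  have R: "finite R" "R \<noteq> {}"
    using w by (auto simp: R_def)
  then have "Max R \<in> R"
    by (rule Max_in)
  then obtain v where v: "v \<in> pverts G" "Max R = \<bar>g v\<bar> / y v"
    unfolding R_def by blast
  define r where "r = Max R"
  have r: "\<bar>g u\<bar> \<le> r * y u" if "u \<in> pverts G" for u
  proof -
    have "\<bar>g u\<bar> / y u \<le> r"
      unfolding r_def using R that by (intro Max_ge) (auto simp: R_def)
    then show ?thesis
      using y[OF that] by (simp add: field_simps)
  qed
  have gv: "\<bar>g v\<bar> = r * y v"
    using v y[OF v(1)] by (simp add: r_def)
  \<comment> \<open>The eigenfunction is nonzero at \<open>w\<close>, so the maximal ratio is
    positive and can be cancelled at the end.\<close>
  have "0 < r * y w"
    using r[OF w(1)] w(2) by linarith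
  then have "0 < r"
    using y[OF w(1)] by (simp add: zero_less_mult_iff)
  have "\<kappa> * (r * y v) \<le> \<bar>\<kappa> * g v\<bar>"
    by (simp add: abs_mult gv[symmetric] mult_right_mono)
  also have "\<dots> = \<bar>\<Sum>u | (v, u) \<in> parcs G. g v - g u\<bar>"
    by (simp add: g[OF v(1)])
  also have "\<dots> \<le> (\<Sum>u | (v, u) \<in> parcs G. \<bar>g v - g u\<bar>)"
    by (rule sum_abs)
  also have "\<dots> \<le> (\<Sum>u | (v, u) \<in> parcs G. r * (y v + y u))"
  proof (rule sum_mono)
    fix u assume "u \<in> {u. (v, u) \<in> parcs G}"
    then have "u \<in> pverts G"
      by (auto dest: in_arcsD2)
    then show "\<bar>g v - g u\<bar> \<le> r * (y v + y u)"
      using r[of u] gv by (simp add: distrib_left)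
  qed
  also have "\<dots> = r * (\<Sum>u | (v, u) \<in> parcs G. y v + y u)"
    by (rule sum_distrib_left[symmetric])
  also have "\<dots> \<le> r * (M * y v)"
    using le[OF v(1)] \<open>0 < r\<close> by simp
  finally show ?thesis
    using \<open>0 < r\<close> y[OF v(1)] by (simp add: mult.assoc[symmetric] mult.commute[of _ r])
qed

lemma finite_spectrum_laplacian: "finite (spectrum (laplacian G))"
  using card_finite_spectrum(1)[OF laplacian_carrier] .

section \<open>Linear trees\<close>

lemma mem_symcl_iff: "(u, v) \<in> symcl R \<longleftrightarrow> (u, v) \<in> R \<or> (v, u) \<in> R"
  by (auto simp: symcl_def)

lemma linear_tree_simps [simp]:
  "pverts (linear_tree Ts) = lt_verts Ts" "parcs (linear_tree Ts) = symcl (lt_arcs Ts)"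
  by (simp_all add: linear_tree_def)

lemma legs_pos: "starlike_tree T \<Longrightarrow> q \<in> set (legs T) \<Longrightarrow> 0 < q"
  by (auto simp: starlike_tree_def legs_def split: if_splits)

lemma sum_neighbours_Spine:
  fixes h :: "lt_vertex \<Rightarrow> real"
  assumes T: "\<And>T. T \<in> set Ts \<Longrightarrow> starlike_tree T" and j: "j < length Ts"
  shows "(\<Sum>u | (Spine j, u) \<in> symcl (lt_arcs Ts). h u) =
    (if Suc j < length Ts then h (Spine (Suc j)) else 0) +
    (if j = 0 then 0 else h (Spine (j - 1))) +
    (\<Sum>i<length (legs (Ts ! j)). h (Pendant j i 0))"
proof -
  let ?A = "if Suc j < length Ts then {Spine (Suc j)} else {}"
  let ?B = "if j = 0 then {} else {Spine (j - 1)}"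
  let ?C = "(\<lambda>i. Pendant j i 0) ` {..<length (legs (Ts ! j))}"
  \<comment> \<open>Every leg is nonempty, so it contributes exactly one neighbour, its vertex
    \<open>Pendant j i 0\<close>.\<close>
  have pos: "0 < legs (Ts ! j) ! i" if "i < length (legs (Ts ! j))" for i
    using legs_pos[of "Ts ! j"] T j that by simp
  have "{u. (Spine j, u) \<in> symcl (lt_arcs Ts)} = ?A \<union> ?B \<union> ?C"
    using j pos by (cases j) (auto simp: mem_symcl_iff lt_arcs_def lt_verts_def image_iff)
  moreover have "sum h (?A \<union> ?B \<union> ?C) = sum h (?A \<union> ?B) + sum h ?C"
    by (intro sum.union_disjoint) auto
  moreover have "sum h (?A \<union> ?B) = sum h ?A + sum h ?B"
    by (intro sum.union_disjoint) auto
  moreover have "sum h ?C = (\<Sum>i<length (legs (Ts ! j)). h (Pendant j i 0))"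
    by (subst sum.reindex) (auto simp: inj_on_def)
  ultimately show ?thesis
    by auto
qed

lemma sum_neighbours_Pendant:
  fixes h :: "lt_vertex \<Rightarrow> real"
  assumes "j < length Ts" "i < length (legs (Ts ! j))" "p < legs (Ts ! j) ! i"
  shows "(\<Sum>u | (Pendant j i p, u) \<in> symcl (lt_arcs Ts). h u) =
    h (if p = 0 then Spine j else Pendant j i (p - 1)) +
    (if Suc p < legs (Ts ! j) ! i then h (Pendant j i (Suc p)) else 0)"
proof -
  let ?A = "{if p = 0 then Spine j else Pendant j i (p - 1)}"
  let ?B = "if Suc p < legs (Ts ! j) ! i then {Pendant j i (Suc p)} else {}"
  have "{u. (Pendant j i p, u) \<in> symcl (lt_arcs Ts)} = ?A \<union> ?B"
    using assms by (auto simp: mem_symcl_iff lt_arcs_def lt_verts_def)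
  moreover have "sum h (?A \<union> ?B) = sum h ?A + sum h ?B"
    by (intro sum.union_disjoint) auto
  ultimately show ?thesis
    by auto
qed

text \<open>The signless Laplacian maps the constant 1 to twice the degree, and a spine vertex has
  at most two spine neighbours and one neighbour per leg.\<close>

lemma spectrum_linear_tree_le:
  assumes T: "\<And>T. T \<in> set Ts \<Longrightarrow> starlike_tree T"
    and B: "\<And>T. T \<in> set Ts \<Longrightarrow> width T \<le> B"
    and \<kappa>: "\<kappa> \<in> spectrum (laplacian (linear_tree Ts))"
  shows "\<kappa> \<le> 2 * real B + 4"
proof (rule eigenvalue_laplacian_le[OF pair_graph_linear_tree, where y = "\<lambda>_. 1"])
  show "eigenvalue (laplacian (linear_tree Ts)) \<kappa>"
    using \<kappa> by (simp add: spectrum_def)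
next
  fix v assume "v \<in> pverts (linear_tree Ts)"
  then consider j where "v = Spine j" "j < length Ts"
    | j i p where "v = Pendant j i p" "j < length Ts" "i < length (legs (Ts ! j))"
        "p < legs (Ts ! j) ! i"
    by (auto simp: lt_verts_def)
  then show "(\<Sum>u | (v, u) \<in> parcs (linear_tree Ts). 1 + (1::real)) \<le> (2 * real B + 4) * 1"
  proof cases
    case (1 j)
    then have "length (legs (Ts ! j)) \<le> B"
      using B[of "Ts ! j"] by (simp add: width_def)
    then show ?thesis
      unfolding 1(1) linear_tree_simps
      by (subst sum_neighbours_Spine) (use T 1 in auto)
  next
    case (2 j i p)
    show ?thesis
      unfolding 2(1) linear_tree_simps
      by (subst sum_neighbours_Pendant) (use 2 in auto)
  qed
qed simp

lemma rho_L_linear_tree_le: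
  assumes "Ts \<noteq> []" "\<And>T. T \<in> set Ts \<Longrightarrow> starlike_tree T" "\<And>T. T \<in> set Ts \<Longrightarrow> width T \<le> B"
  shows "rho_L (linear_tree Ts) \<le> 2 * real B + 4"
proof -
  \<comment> \<open>\<open>Max\<close> is only meaningful on a nonempty spectrum; constant functions
    lie in the kernel.\<close>
  have "eigenvalue (laplacian (linear_tree Ts)) 0"
    unfolding eigenvalue_laplacian_iff[OF pair_graph_linear_tree]
    using assms(1) by (intro exI[of _ "\<lambda>_. 1"]) (auto simp: lt_verts_def)
  then have "spectrum (laplacian (linear_tree Ts)) \<noteq> {}"
    by (auto simp: spectrum_def)
  then show ?thesis
    unfolding rho_L_def using spectrum_linear_tree_le[OF assms(2,3)]
    by (subst Max_le_iff) (auto simp: finite_spectrum_laplacian)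
qed

section \<open>The largest eigenvalue from the pivots\<close>

lemma drift_conv_sum:
  "drift T \<nu> = (\<Sum>i<length (legs T). 1 - 1 / path_b \<nu> (legs T ! i))"
  unfolding drift_def sum_list_sum_nth by (simp add: lessThan_atLeast0)

text \<open>
  The numbers \<open>a\<close> and \<open>path_b \<nu>\<close> are the pivots of Gaussian elimination for \<open>L - \<nu> I\<close> from the
  leaves to the last spine vertex.  Back substitution along the tree, where the value at a vertex
  is the value at its parent divided by minus the pivot, gives the positive function \<open>y\<close> below;
  with alternating signs it is a \<open>\<nu>\<close>-eigenfunction of \<open>L\<close>.
\<close>

lemma rho_L_linear_tree_eqI:
  fixes a :: "nat \<Rightarrow> real"
  assumes T: "\<And>T. T \<in> set Ts \<Longrightarrow> starlike_tree T" and ne: "Ts \<noteq> []"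
    and a: "\<And>j. j < length Ts \<Longrightarrow> a j = (if j = 0 then 0 else 1 - 1 / a (j - 1)) +
        (if Suc j < length Ts then 1 else 0) - \<nu> + drift (Ts ! j) \<nu>"
    and neg: "\<And>j. Suc j < length Ts \<Longrightarrow> a j < 0"
    and zero: "a (length Ts - 1) = 0"
    and b: "\<And>T q i. T \<in> set Ts \<Longrightarrow> q \<in> set (legs T) \<Longrightarrow> 0 < i \<Longrightarrow> i \<le> q \<Longrightarrow> path_b \<nu> i < 0"
  shows "rho_L (linear_tree Ts) = \<nu>"
proof -
  define n where "n = length Ts"
  \<comment> \<open>Scaled to 1 at the last spine vertex, where the product is empty; the last
    pivot, which is 0, is never a divisor.\<close>
  define ys where "ys j = (\<Prod>l=j..<n - 1. - 1 / a l)" for j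
  define q where "q j i = legs (Ts ! j) ! i" for j i
  \<comment> \<open>From depth \<open>p\<close> on, a path with \<open>q\<close> vertices has
    \<open>q - p\<close> of them left, hence the pivot there is
    \<open>path_b \<nu> (q - p)\<close>.\<close>
  define yp where "yp j i p = ys j * (\<Prod>l=q j i - p..q j i. - 1 / path_b \<nu> l)" for j i p
  define y where "y v = (case v of Spine j \<Rightarrow> ys j | Pendant j i p \<Rightarrow> yp j i p)" for v
  \<comment> \<open>The parity of the distance from \<open>Spine 0\<close>, a proper 2-colouring of
    the tree by signs.\<close>
  define s :: "lt_vertex \<Rightarrow> real" where
    "s v = (case v of Spine j \<Rightarrow> (-1) ^ j | Pendant j i p \<Rightarrow> (-1) ^ (j + p + 1))" for v
  have y_simps [simp]: "y (Spine j) = ys j" "y (Pendant j i p) = yp j i p" for j i p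
    by (simp_all add: y_def)
  have n: "0 < n"
    using ne by (simp add: n_def)
  have bq: "path_b \<nu> l < 0" if "j < n" "i < length (legs (Ts ! j))" "0 < l" "l \<le> q j i" for j i l
    using b[of "Ts ! j" "q j i" l] that by (simp add: n_def q_def)
  have ys_pos: "0 < ys j" for j
    unfolding ys_def using neg by (intro prod_pos) (auto simp: n_def)
  have yp_pos: "0 < yp j i p" if "j < n" "i < length (legs (Ts ! j))" "p < q j i" for j i p
    unfolding yp_def using bq[OF that(1,2)] that(3)
    by (intro mult_pos_pos ys_pos prod_pos) auto
  have ys_Suc: "ys (Suc j) = - a j * ys j" if "Suc j < n" for j
  proof -
    have "ys j = - 1 / a j * ys (Suc j)"
      unfolding ys_def using that by (subst prod.atLeast_Suc_lessThan) auto
    then show ?thesis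
      using neg[of j] that by (simp add: n_def)
  qed
  have ys_pred: "ys (j - 1) = - 1 / a (j - 1) * ys j" if "0 < j" "j < n" for j
    using ys_Suc[of "j - 1"] neg[of "j - 1"] that by (simp add: n_def)
  have yp_0: "yp j i 0 = - 1 / path_b \<nu> (q j i) * ys j" for j i
    by (simp add: yp_def)
  have yp_Suc: "yp j i (Suc p) = - 1 / path_b \<nu> (q j i - Suc p) * yp j i p"
    if "Suc p < q j i" for j i p
  proof -
    have "{q j i - Suc p..q j i} = insert (q j i - Suc p) {q j i - p..q j i}"
      using that by auto
    then show ?thesis
      using that by (simp add: yp_def)
  qed
  have yp_parent: "(if p = 0 then ys j else yp j i (p - 1)) = - path_b \<nu> (q j i - p) * yp j i p"
    if "j < n" "i < length (legs (Ts ! j))" "p < q j i" for j i p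
  proof (cases p)
    case 0
    then show ?thesis
      using yp_0[of j i] bq[OF that(1,2), of "q j i"] that(3) by simp
  next
    case (Suc p')
    then show ?thesis
      using yp_Suc[of p' j i] bq[OF that(1,2), of "q j i - p"] that(3) by simp
  qed
  have y_pos: "0 < y v" if "v \<in> lt_verts Ts" for v
    using that ys_pos yp_pos by (auto simp: lt_verts_def n_def q_def)
  have signless: "(\<Sum>u | (v, u) \<in> symcl (lt_arcs Ts). y v + y u) = \<nu> * y v"
    if v: "v \<in> lt_verts Ts" for v
  proof -
    from v consider j where "v = Spine j" "j < n"
      | j i p where "v = Pendant j i p" "j < n" "i < length (legs (Ts ! j))" "p < q j i"
      by (auto simp: lt_verts_def n_def q_def)
    then show ?thesis
    proof cases
      case (1 j)
      \<comment> \<open>At the last spine vertex both sides vanish because the last pivot is 0; this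
        is where \<nu> becomes an eigenvalue.\<close>
      have up: "(if Suc j < n then ys j + ys (Suc j) else 0) =
          ((if Suc j < n then 1 else 0) - a j) * ys j"
        using ys_Suc[of j] zero 1(2) by (auto simp: algebra_simps n_def not_less_eq less_Suc_eq)
      have down: "(if j = 0 then 0 else ys j + ys (j - 1)) =
          (if j = 0 then 0 else 1 - 1 / a (j - 1)) * ys j"
        using ys_pred[of j] 1(2) by (auto simp: algebra_simps)
      have "(\<Sum>u | (v, u) \<in> symcl (lt_arcs Ts). y v + y u) =
          (if Suc j < n then ys j + ys (Suc j) else 0) +
          (if j = 0 then 0 else ys j + ys (j - 1)) +
          (\<Sum>i<length (legs (Ts ! j)). ys j + yp j i 0)"
        unfolding 1(1) using 1(2) T by (subst sum_neighbours_Spine) (auto simp: n_def)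
      also have "(\<Sum>i<length (legs (Ts ! j)). ys j + yp j i 0) = drift (Ts ! j) \<nu> * ys j"
        unfolding drift_conv_sum sum_distrib_right
        by (intro sum.cong) (auto simp: yp_0 q_def algebra_simps)
      also have "(if Suc j < n then ys j + ys (Suc j) else 0) +
          (if j = 0 then 0 else ys j + ys (j - 1)) + drift (Ts ! j) \<nu> * ys j =
          ((if j = 0 then 0 else 1 - 1 / a (j - 1)) + (if Suc j < n then 1 else 0)
            + drift (Ts ! j) \<nu> - a j) * ys j"
        unfolding up down by (simp only: distrib_right left_diff_distrib)
      also have "(if j = 0 then 0 else 1 - 1 / a (j - 1)) + (if Suc j < n then 1 else 0)
            + drift (Ts ! j) \<nu> - a j = \<nu>"
        using a[of j] 1(2) unfolding n_def by linarith
      finally show ?thesis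
        by (simp add: 1(1))
    next
      case (2 j i p)
      have "(\<Sum>u | (v, u) \<in> symcl (lt_arcs Ts). y v + y u) =
          yp j i p + (if p = 0 then ys j else yp j i (p - 1)) +
          (if Suc p < q j i then yp j i p + yp j i (Suc p) else 0)"
        unfolding 2(1) using 2(2,3,4) by (subst sum_neighbours_Pendant) (auto simp: n_def q_def)
      also have "\<dots> = \<nu> * yp j i p"
      proof (cases "Suc p < q j i")
        case True
        \<comment> \<open>Before the end of the path at least two vertices remain, so the recursion
          for \<open>path_b\<close> applies; at the end the pivot is
          \<open>1 - \<nu>\<close>.\<close>
        then have "q j i - p = Suc (Suc (q j i - p - 2))" "q j i - Suc p = Suc (q j i - p - 2)"
          by simp_all
        then have "path_b \<nu> (q j i - p) = 2 - \<nu> - 1 / path_b \<nu> (q j i - Suc p)"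
          by (metis path_b.simps(3))
        then have \<nu>: "2 - path_b \<nu> (q j i - p) - 1 / path_b \<nu> (q j i - Suc p) = \<nu>"
          by simp
        have "yp j i p + (if p = 0 then ys j else yp j i (p - 1)) +
            (if Suc p < q j i then yp j i p + yp j i (Suc p) else 0) =
            (2 - path_b \<nu> (q j i - p) - 1 / path_b \<nu> (q j i - Suc p)) * yp j i p"
          using True unfolding yp_parent[OF 2(2,3,4)] by (simp add: yp_Suc algebra_simps)
        then show ?thesis
          unfolding \<nu> .
      next
        case False
        then have "q j i - p = Suc 0"
          using 2(4) by simp
        with False show ?thesis
          by (simp add: yp_parent[OF 2(2,3,4)] algebra_simps)
      qed
      finally show ?thesis
        by (simp add: 2(1))
    qed
  qed
  have s_arc: "s u = - s v" if "(v, u) \<in> symcl (lt_arcs Ts)" for v u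
    using that by (auto simp: mem_symcl_iff lt_arcs_def s_def)
  \<comment> \<open>Signs alternate along arcs, so multiplication by \<open>s\<close> turns the
    signless equation for \<open>y\<close> into the Laplacian one.\<close>
  have "(\<Sum>u | (v, u) \<in> symcl (lt_arcs Ts). s v * y v - s u * y u) = \<nu> * (s v * y v)"
    if "v \<in> lt_verts Ts" for v
  proof -
    have "(\<Sum>u | (v, u) \<in> symcl (lt_arcs Ts). s v * y v - s u * y u) =
        (\<Sum>u | (v, u) \<in> symcl (lt_arcs Ts). s v * (y v + y u))"
      by (intro sum.cong) (auto simp: s_arc distrib_left)
    also have "\<dots> = \<nu> * (s v * y v)"
      by (simp add: sum_distrib_left[symmetric] signless[OF that])
    finally show ?thesis .
  qed
  moreover have "Spine 0 \<in> lt_verts Ts" "s (Spine 0) * y (Spine 0) \<noteq> 0"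
    using n ys_pos[of 0] by (auto simp: lt_verts_def n_def s_def)
  ultimately have "eigenvalue (laplacian (linear_tree Ts)) \<nu>"
    unfolding eigenvalue_laplacian_iff[OF pair_graph_linear_tree] linear_tree_simps
    by (intro exI[of _ "\<lambda>v. s v * y v"]) blast
  \<comment> \<open>\<open>y\<close> is positive and satisfies the signless equation with equality,
    so it serves as the supersolution with \<open>M = \<nu>\<close>.\<close>
  moreover have "\<kappa> \<le> \<nu>" if "eigenvalue (laplacian (linear_tree Ts)) \<kappa>" for \<kappa>
    using eigenvalue_laplacian_le[OF pair_graph_linear_tree that, of y \<nu>] y_pos signless by simp
  ultimately show ?thesis
    unfolding rho_L_def
    using finite_spectrum_laplacian[of "linear_tree Ts"]
    by (intro Max_eqI) (auto simp: spectrum_def)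
qed

section \<open>Largest zeros of the pivots\<close>

text \<open>Makes \<open>t\<close> the largest zero of \<open>h\<close>. Only the ray from
  \<open>t\<close> on is constrained, because pivots may have poles to the left of
  \<open>t\<close>.\<close>

definition top_zero :: "(real \<Rightarrow> real) \<Rightarrow> real \<Rightarrow> bool" where
  "top_zero h t \<longleftrightarrow> h t = 0 \<and> continuous_on {t..} h \<and> (\<forall>x y. t \<le> x \<longrightarrow> x < y \<longrightarrow> h y < h x)"

lemma top_zero_neg: "top_zero h t \<Longrightarrow> t < x \<Longrightarrow> h x < 0"
  unfolding top_zero_def by (metis order_refl)

text \<open>
  The new zero exists by the intermediate value theorem: the sum tends to \<open>\<infinity>\<close> when \<open>\<nu>\<close> decreases
  to the largest of the old zeros, and \<open>- \<nu>\<close> wins for large \<open>\<nu>\<close>.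
\<close>

lemma top_zero_step:
  fixes hs :: "(real \<Rightarrow> real) list"
  assumes "\<And>h. h \<in> set hs \<Longrightarrow> \<exists>t. top_zero h t"
  shows "\<exists>t. top_zero (\<lambda>\<nu>. c - \<nu> - (\<Sum>h\<leftarrow>hs. 1 / h \<nu>)) t \<and>
    (\<forall>h\<in>set hs. \<forall>\<nu>\<ge>t. h \<nu> < 0)"
proof (cases "hs = []")
  case True
  then show ?thesis
    by (intro exI[of _ c]) (auto simp: top_zero_def intro!: continuous_intros)
next
  case False
  define H where "H \<nu> = c - \<nu> - (\<Sum>h\<leftarrow>hs. 1 / h \<nu>)" for \<nu>
  obtain t where t: "\<And>h. h \<in> set hs \<Longrightarrow> top_zero h (t h)"
    using assms by metis
  \<comment> \<open>Beyond \<open>m\<close> all old functions are negative, so the sum of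
    reciprocals has no poles there; some old function vanishes at \<open>m\<close> itself and makes
    the sum blow up.\<close>
  define m where "m = Max (t ` set hs)"
  have m_ge: "t h \<le> m" if "h \<in> set hs" for h
    unfolding m_def using that by (intro Max_ge) auto
  have "m \<in> t ` set hs"
    unfolding m_def using False by (intro Max_in) auto
  then obtain g where g: "g \<in> set hs" "t g = m"
    by auto
  have neg: "h x < 0" if "h \<in> set hs" "m < x" for h x
    using top_zero_neg[OF t[OF that(1)]] m_ge[OF that(1)] that(2) by force
  have decr: "h y < h x" if "h \<in> set hs" "m < x" "x < y" for h x y
    using t[OF that(1)] m_ge[OF that(1)] that(2,3) unfolding top_zero_def
    by (meson less_imp_le order_trans)
  have inv: "0 \<le> - (1 / h x)" if "h \<in> set hs" "m < x" for h x
    using neg[OF that] by simp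
  have inv_decr: "- (1 / h y) \<le> - (1 / h x)" if "h \<in> set hs" "m < x" "x < y" for h x y
    using decr[OF that] neg[of h x] neg[of h y] that by (simp add: field_simps)
  have H_decr: "H y < H x" if "m < x" "x < y" for x y
  proof -
    have "(\<Sum>h\<leftarrow>hs. 1 / h x) \<le> (\<Sum>h\<leftarrow>hs. 1 / h y)"
      using inv_decr[OF _ that] by (intro sum_list_mono) simp
    then show ?thesis
      using that by (simp add: H_def)
  qed
  have H_cont: "continuous_on {x..} H" if x: "m < x" for x
  proof -
    have "continuous_on {x..} (\<lambda>\<nu>. \<Sum>h\<leftarrow>hs. 1 / h \<nu>)"
      unfolding sum_list_sum_nth length_map
    proof (intro continuous_on_sum)
      fix i assume "i \<in> {0..<length hs}"
      then have i: "i < length hs" "hs ! i \<in> set hs"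
        by simp_all
      have "continuous_on {x..} (hs ! i)"
        using t[OF i(2)] m_ge[OF i(2)] x unfolding top_zero_def
        by (auto elim!: continuous_on_subset)
      moreover have "(hs ! i) \<nu> \<noteq> 0" if "x \<le> \<nu>" for \<nu>
        using neg[OF i(2), of \<nu>] x that by simp
      ultimately have "continuous_on {x..} (\<lambda>\<nu>. 1 / (hs ! i) \<nu>)"
        by (intro continuous_intros) auto
      then show "continuous_on {x..} (\<lambda>\<nu>. map (\<lambda>h. 1 / h \<nu>) hs ! i)"
        using i(1) by simp
    qed
    then show ?thesis
      unfolding H_def by (intro continuous_intros)
  qed
  obtain x0 where x0: "m < x0" "x0 < m + 1" "0 < H x0"
  proof -
    \<comment> \<open>For \<open>x < m + 1\<close> near \<open>m\<close> one has
      \<open>c - x > - K\<close>, so a single term \<open>- (1 / h x)\<close> larger than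
      \<open>K\<close> forces \<open>H x > 0\<close>, the other terms being nonnegative.\<close>
    define K where "K = \<bar>c\<bar> + \<bar>m\<bar> + 2"
    have "K > 0"
      by (simp add: K_def)
    have "continuous_on {m..} g" "g m = 0"
      using t[OF g(1)] g(2) by (auto simp: top_zero_def)
    then have "(g \<longlongrightarrow> 0) (at m within {m..})"
      unfolding continuous_on_def by force
    then have "\<forall>\<^sub>F x in at m within {m..}. dist (g x) 0 < 1 / K"
      using \<open>K > 0\<close> by (intro tendstoD) auto
    then obtain d where d: "0 < d" "\<And>x. m < x \<Longrightarrow> dist x m < d \<Longrightarrow> dist (g x) 0 < 1 / K"
      unfolding eventually_at by force
    define x where "x = m + min d 1 / 2"
    have x: "m < x" "x < m + 1" "dist x m < d"
      using d(1) by (auto simp: x_def dist_real_def min_def)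
    have gx: "g x < 0" "- g x < 1 / K"
      using neg[OF g(1) x(1)] d(2)[of x] x by (auto simp: dist_real_def)
    then have "K < - (1 / g x)"
      using \<open>K > 0\<close> by (simp add: field_simps)
    also have "- (1 / g x) \<le> (\<Sum>h\<leftarrow>hs. - (1 / h x))"
      using g(1) inv[OF _ x(1)] by (intro member_le_sum_list) auto
    also have "\<dots> = - (\<Sum>h\<leftarrow>hs. 1 / h x)"
      by (simp add: uminus_sum_list_map o_def)
    finally have "0 < H x"
      using x(2) by (auto simp: H_def K_def)
    with x that show ?thesis
      by blast
  qed
  obtain x1 where x1: "m + 1 < x1" "H x1 < 0"
  proof -
    define D where "D = (\<Sum>h\<leftarrow>hs. - (1 / h (m + 1)))"
    \<comment> \<open>Beyond \<open>m + 1\<close> the reciprocals contribute at most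
      \<open>D\<close>, so \<open>x \<ge> c + D + 1\<close> gives
      \<open>H x \<le> -1\<close>.\<close>
    define x where "x = max (m + 2) (c + D + 1)"
    have "(\<Sum>h\<leftarrow>hs. - (1 / h x)) \<le> D"
      unfolding D_def using inv_decr[of _ "m + 1" x] by (intro sum_list_mono) (auto simp: x_def)
    moreover have "(\<Sum>h\<leftarrow>hs. - (1 / h x)) = - (\<Sum>h\<leftarrow>hs. 1 / h x)"
      by (simp add: uminus_sum_list_map o_def)
    ultimately have "H x < 0"
      by (auto simp: H_def x_def)
    then show ?thesis
      by (intro that[of x]) (auto simp: x_def)
  qed
  have "continuous_on {x0..x1} H"
    using H_cont[OF x0(1)] by (rule continuous_on_subset) auto
  then obtain z where z: "x0 \<le> z" "z \<le> x1" "H z = 0"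
    using IVT2'[of H x1 0 x0] x0 x1 by auto
  with x0 have "m < z"
    by simp
  then have "top_zero H z" "\<forall>h\<in>set hs. \<forall>\<nu>\<ge>z. h \<nu> < 0"
    using z(3) H_cont H_decr neg by (auto simp: top_zero_def)
  then show ?thesis
    unfolding H_def by blast
qed

text \<open>Each recursion step is \<open>top_zero_step\<close> with the single function
  \<open>path_b \<nu> q\<close>, and the largest zeros move to the right, so earlier pivots stay
  negative.\<close>

lemma top_zero_path_b:
  assumes "0 < q"
  shows "\<exists>t. top_zero (\<lambda>\<nu>. path_b \<nu> q) t \<and> (\<forall>\<nu>\<ge>t. \<forall>i. 0 < i \<longrightarrow> i < q \<longrightarrow> path_b \<nu> i < 0)"
  using assms
proof (induction q rule: nat_induct_non_zero)
  case 1
  then show ?case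
    using top_zero_step[of "[]" 1] by auto
next
  case (Suc q)
  then obtain t where t: "top_zero (\<lambda>\<nu>. path_b \<nu> q) t"
      "\<And>\<nu> i. t \<le> \<nu> \<Longrightarrow> 0 < i \<Longrightarrow> i < q \<Longrightarrow> path_b \<nu> i < 0"
    by blast
  obtain t' where t': "top_zero (\<lambda>\<nu>. 2 - \<nu> - 1 / path_b \<nu> q) t'"
      "\<And>\<nu>. t' \<le> \<nu> \<Longrightarrow> path_b \<nu> q < 0"
    using top_zero_step[of "[\<lambda>\<nu>. path_b \<nu> q]" 2] t(1) by auto
  \<comment> \<open>The old pivot vanishes at \<open>t\<close> but is negative from
    \<open>t'\<close> on, so \<open>t\<close> lies to the left of \<open>t'\<close>.\<close>
  have "t \<le> t'"
    using t'(2)[of t] t(1) by (force simp: top_zero_def)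
  have "path_b \<nu> i < 0" if "t' \<le> \<nu>" "0 < i" "i < Suc q" for \<nu> i
    using t(2)[of \<nu> i] t'(2)[of \<nu>] \<open>t \<le> t'\<close> that by (cases "i = q") auto
  moreover have "(\<lambda>\<nu>::real. path_b \<nu> (Suc q)) = (\<lambda>\<nu>. 2 - \<nu> - 1 / path_b \<nu> q)"
    using \<open>0 < q\<close> by (cases q) auto
  ultimately show ?case
    using t'(1) by auto
qed

text \<open>Includes the intermediate pivots of each pendant path: their sign makes the
  eigenfunction positive and keeps all divisors in the drift nonzero.\<close>

definition legs_neg :: "nat list \<Rightarrow> real \<Rightarrow> bool" where
  "legs_neg T \<nu> \<longleftrightarrow> (\<forall>q\<in>set (legs T). \<forall>i. 0 < i \<longrightarrow> i \<le> q \<longrightarrow> path_b \<nu> i < 0)"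

text \<open>The drift is the number of legs minus the reciprocals of the leg pivots, so it enlarges
  \<open>c\<close> and adds these pivots to the list in \<open>top_zero_step\<close>.\<close>

lemma top_zero_drift:
  assumes T: "starlike_tree T" and hs: "\<And>h. h \<in> set hs \<Longrightarrow> \<exists>t. top_zero h t"
  shows "\<exists>t. top_zero (\<lambda>\<nu>. c - \<nu> - (\<Sum>h\<leftarrow>hs. 1 / h \<nu>) + drift T \<nu>) t \<and>
    (\<forall>\<nu>\<ge>t. (\<forall>h\<in>set hs. h \<nu> < 0) \<and> legs_neg T \<nu>)"
proof -
  let ?b = "\<lambda>q \<nu>. path_b \<nu> q :: real"
  let ?hs = "hs @ map ?b (legs T)"
  have pos: "0 < q" if "q \<in> set (legs T)" for q
    using legs_pos[OF T that] .
  have "\<exists>t. top_zero h t" if "h \<in> set ?hs" for h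
  proof -
    from that consider "h \<in> set hs" | q where "q \<in> set (legs T)" "h = ?b q"
      by auto
    then show ?thesis
    proof cases
      case 1
      then show ?thesis
        by (rule hs)
    next
      case 2
      then show ?thesis
        using top_zero_path_b[OF pos] by metis
    qed
  qed
  from top_zero_step[of ?hs "c + length (legs T)", OF this]
  obtain t where t: "top_zero (\<lambda>\<nu>. c + length (legs T) - \<nu> - (\<Sum>h\<leftarrow>?hs. 1 / h \<nu>)) t"
      "\<And>h \<nu>. h \<in> set ?hs \<Longrightarrow> t \<le> \<nu> \<Longrightarrow> h \<nu> < 0"
    by blast
  have "drift T \<nu> = length (legs T) - (\<Sum>q\<leftarrow>legs T. 1 / path_b \<nu> q)" for \<nu> :: real
    by (simp add: drift_def sum_list_subtractf sum_list_triv)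
  then have eq: "(\<lambda>\<nu>. c + length (legs T) - \<nu> - (\<Sum>h\<leftarrow>?hs. 1 / h \<nu>)) =
      (\<lambda>\<nu>. c - \<nu> - (\<Sum>h\<leftarrow>hs. 1 / h \<nu>) + drift T \<nu>)"
    by (simp add: o_def fun_eq_iff)
  have "legs_neg T \<nu>" if "t \<le> \<nu>" for \<nu>
    unfolding legs_neg_def
  proof (intro ballI allI impI)
    fix q i assume q: "q \<in> set (legs T)" and i: "0 < i" "i \<le> q"
    obtain t' where t': "top_zero (?b q) t'" "\<And>\<nu> i. t' \<le> \<nu> \<Longrightarrow> 0 < i \<Longrightarrow> i < q \<Longrightarrow> path_b \<nu> i < 0"
      using top_zero_path_b[OF pos[OF q]] by blast
    have "?b q \<in> set ?hs"
      using q by auto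
    then have neg: "path_b x q < 0" if "t \<le> x" for x
      using t(2)[of "?b q" x] that by simp
    have "t' < t"
      using neg[of t'] t'(1) by (force simp: top_zero_def)
    with that show "path_b \<nu> i < 0"
      using neg[of \<nu>] t'(2)[of \<nu> i] i by (cases "i = q") auto
  qed
  with t show ?thesis
    unfolding eq by (intro exI[of _ t]) auto
qed

text \<open>Induction along the spine; the constant is 1 at the first vertex, which has no
  predecessor, and 2 afterwards.\<close>

lemma top_zero_S_inner:
  assumes T: "\<And>j. 1 \<le> j \<Longrightarrow> starlike_tree (T j)" and k: "0 < k"
  shows "\<exists>t. top_zero (\<lambda>\<nu>. S_inner T \<nu> k) t \<and>
    (\<forall>\<nu>\<ge>t. (\<forall>j. 1 \<le> j \<longrightarrow> j < k \<longrightarrow> S_inner T \<nu> j < 0) \<and>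
      (\<forall>j. 1 \<le> j \<longrightarrow> j \<le> k \<longrightarrow> legs_neg (T j) \<nu>))"
  using k
proof (induction k rule: nat_induct_non_zero)
  case 1
  obtain t where t: "top_zero (\<lambda>\<nu>. 1 - \<nu> + drift (T 1) \<nu>) t" "\<forall>\<nu>\<ge>t. legs_neg (T 1) \<nu>"
    using top_zero_drift[of "T 1" "[]" 1] T[of 1] by auto
  have "legs_neg (T j) \<nu>" if "t \<le> \<nu>" "1 \<le> j" "j \<le> 1" for \<nu> j
    using t(2) that by (cases "j = 1") auto
  with t(1) show ?case
    by (intro exI[of _ t]) auto
next
  case (Suc k)
  then obtain t where t: "top_zero (\<lambda>\<nu>. S_inner T \<nu> k) t"
      "\<And>\<nu> j. t \<le> \<nu> \<Longrightarrow> 1 \<le> j \<Longrightarrow> j < k \<Longrightarrow> S_inner T \<nu> j < 0"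
      "\<And>\<nu> j. t \<le> \<nu> \<Longrightarrow> 1 \<le> j \<Longrightarrow> j \<le> k \<Longrightarrow> legs_neg (T j) \<nu>"
    by blast
  obtain t' where t': "top_zero (\<lambda>\<nu>. 2 - \<nu> - 1 / S_inner T \<nu> k + drift (T (Suc k)) \<nu>) t'"
      "\<And>\<nu>. t' \<le> \<nu> \<Longrightarrow> S_inner T \<nu> k < 0" "\<And>\<nu>. t' \<le> \<nu> \<Longrightarrow> legs_neg (T (Suc k)) \<nu>"
    using top_zero_drift[of "T (Suc k)" "[\<lambda>\<nu>. S_inner T \<nu> k]" 2] T[of "Suc k"] t(1) by auto
  have "t \<le> t'"
    using t'(2)[of t] t(1) by (force simp: top_zero_def)
  have "S_inner T \<nu> j < 0" if "t' \<le> \<nu>" "1 \<le> j" "j < Suc k" for \<nu> j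
    using t(2)[of \<nu> j] t'(2)[of \<nu>] \<open>t \<le> t'\<close> that by (cases "j = k") auto
  moreover have "legs_neg (T j) \<nu>" if "t' \<le> \<nu>" "1 \<le> j" "j \<le> Suc k" for \<nu> j
    using t(3)[of \<nu> j] t'(3)[of \<nu>] \<open>t \<le> t'\<close> that by (cases "j = Suc k") auto
  moreover have "(\<lambda>\<nu>::real. S_inner T \<nu> (Suc k)) =
      (\<lambda>\<nu>. 2 - \<nu> - 1 / S_inner T \<nu> k + drift (T (Suc k)) \<nu>)"
    using \<open>0 < k\<close> by (cases k) (auto simp: psi_def)
  ultimately show ?case
    using t'(1) by auto
qed

text \<open>The last spine vertex has no successor, so the constant drops from 2 to 1; this is the
  summand -1 in \<open>S_last\<close>.\<close>

lemma top_zero_S_last: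
  assumes T: "\<And>j. 1 \<le> j \<Longrightarrow> starlike_tree (T j)" and C: "starlike_tree (C k)" and k: "2 \<le> k"
  shows "\<exists>t. top_zero (\<lambda>\<nu>. S_last T C \<nu> k) t \<and>
    (\<forall>\<nu>\<ge>t. legs_neg (C k) \<nu> \<and>
      (\<forall>j. 1 \<le> j \<longrightarrow> j < k \<longrightarrow> S_inner T \<nu> j < 0 \<and> legs_neg (T j) \<nu>))"
proof -
  from k have "0 < k - 1"
    by simp
  with top_zero_S_inner[of T "k - 1"] T obtain t where
      t: "top_zero (\<lambda>\<nu>. S_inner T \<nu> (k - 1)) t"
      "\<And>\<nu> j. t \<le> \<nu> \<Longrightarrow> 1 \<le> j \<Longrightarrow> j < k - 1 \<Longrightarrow> S_inner T \<nu> j < 0"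
      "\<And>\<nu> j. t \<le> \<nu> \<Longrightarrow> 1 \<le> j \<Longrightarrow> j \<le> k - 1 \<Longrightarrow> legs_neg (T j) \<nu>"
    by blast
  obtain t' where t': "top_zero (\<lambda>\<nu>. 1 - \<nu> - 1 / S_inner T \<nu> (k - 1) + drift (C k) \<nu>) t'"
      "\<And>\<nu>. t' \<le> \<nu> \<Longrightarrow> S_inner T \<nu> (k - 1) < 0" "\<And>\<nu>. t' \<le> \<nu> \<Longrightarrow> legs_neg (C k) \<nu>"
    using top_zero_drift[of "C k" "[\<lambda>\<nu>. S_inner T \<nu> (k - 1)]" 1] C t(1) by auto
  have "t \<le> t'"
    using t'(2)[of t] t(1) by (force simp: top_zero_def)
  have "S_inner T \<nu> j < 0 \<and> legs_neg (T j) \<nu>" if "t' \<le> \<nu>" "1 \<le> j" "j < k" for \<nu> j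
    using t(2,3)[of \<nu> j] t'(2)[of \<nu>] \<open>t \<le> t'\<close> that by (cases "j = k - 1") auto
  moreover have "(\<lambda>\<nu>::real. S_last T C \<nu> k) =
      (\<lambda>\<nu>. 1 - \<nu> - 1 / S_inner T \<nu> (k - 1) + drift (C k) \<nu>)"
    by (auto simp: S_last_def psi_def)
  ultimately show ?thesis
    using t'(1,3) by (intro exI[of _ t']) simp
qed

section \<open>Values of rational functions\<close>

text \<open>A relation, since a value exists only where some denominator is nonzero. It transfers
  the real recursion to fractions without relying on \<open>1 / 0 = 0\<close>.\<close>

definition rat_value :: "real poly fract \<Rightarrow> real \<Rightarrow> real \<Rightarrow> bool" where
  "rat_value f x v \<longleftrightarrow> (\<exists>p q. f = Fract p q \<and> poly q x \<noteq> 0 \<and> v = poly p x / poly q x)"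

lemma rat_value_Fract: "poly q x \<noteq> 0 \<Longrightarrow> rat_value (Fract p q) x (poly p x / poly q x)"
  by (auto simp: rat_value_def)

lemma rat_valueE:
  assumes "rat_value f x v"
  obtains p q where "f = Fract p q" "q \<noteq> 0" "poly q x \<noteq> 0" "v = poly p x / poly q x"
  using assms unfolding rat_value_def by (metis poly_0)

lemma rat_value_1: "rat_value 1 x 1"
  using rat_value_Fract[of 1 x 1] by (simp add: One_fract_def)

lemma rat_value_add:
  assumes "rat_value f x v" "rat_value g x w"
  shows "rat_value (f + g) x (v + w)"
proof -
  obtain p q where f: "f = Fract p q" "q \<noteq> 0" "poly q x \<noteq> 0" "v = poly p x / poly q x"
    using assms(1) by (rule rat_valueE)
  obtain r s where g: "g = Fract r s" "s \<noteq> 0" "poly s x \<noteq> 0" "w = poly r x / poly s x"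
    using assms(2) by (rule rat_valueE)
  show ?thesis
    using f g rat_value_Fract[of "q * s" x "p * s + r * q"] by (simp add: add_frac_eq)
qed

lemma rat_value_uminus:
  assumes "rat_value f x v"
  shows "rat_value (- f) x (- v)"
  using assms
proof (rule rat_valueE)
  fix p q assume "f = Fract p q" "q \<noteq> 0" "poly q x \<noteq> 0" "v = poly p x / poly q x"
  then show ?thesis
    using rat_value_Fract[of q x "- p"] by simp
qed

lemma rat_value_diff:
  assumes "rat_value f x v" "rat_value g x w"
  shows "rat_value (f - g) x (v - w)"
  using rat_value_add[OF assms(1) rat_value_uminus[OF assms(2)]] by simp

lemma rat_value_inverse:
  assumes "rat_value f x v" "v \<noteq> 0"
  shows "rat_value (1 / f) x (1 / v)"
  using assms(1)
proof (rule rat_valueE)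
  fix p q assume "f = Fract p q" "q \<noteq> 0" "poly q x \<noteq> 0" "v = poly p x / poly q x"
  then show ?thesis
    using rat_value_Fract[of p x q] assms(2) by (auto simp: inverse_eq_divide[symmetric])
qed

lemma rat_value_2: "rat_value 2 x 2"
  using rat_value_add[OF rat_value_1 rat_value_1, of x] by simp

text \<open>Cross-multiplying two representations shows that vanishing of the numerator is the same
  for all of them with nonzero denominator at \<open>x\<close>.\<close>

lemma rat_zero_iff:
  assumes "rat_value f x v"
  shows "rat_zero f x \<longleftrightarrow> v = 0"
proof -
  obtain p q where f: "f = Fract p q" "q \<noteq> 0" "poly q x \<noteq> 0" "v = poly p x / poly q x"
    using assms by (rule rat_valueE)
  have "poly p x = 0" if "f = Fract r s" "poly s x \<noteq> 0" "poly r x = 0" for r s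
  proof -
    have "s \<noteq> 0"
      using that(2) by auto
    then have "p * s = r * q"
      using f(1,2) that(1) by (simp add: eq_fract)
    then have "poly p x * poly s x = poly r x * poly q x"
      by (metis poly_mult)
    with that show ?thesis
      by simp
  qed
  then show ?thesis
    using f unfolding rat_zero_def by (metis divide_eq_0_iff)
qed

text \<open>Only the pivots before \<open>q\<close> occur as divisors, so
  \<open>path_b \<nu> q\<close> itself may vanish.\<close>

lemma rat_value_path_b:
  assumes "rat_value f x \<nu>" "0 < q" "\<And>i. 0 < i \<Longrightarrow> i < q \<Longrightarrow> path_b \<nu> i \<noteq> 0"
  shows "rat_value (path_b f q) x (path_b \<nu> q)"
  using assms(2,3)
proof (induction q rule: nat_induct_non_zero)
  case 1
  show ?case
    using rat_value_diff[OF rat_value_1 assms(1)] by simp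
next
  case (Suc q)
  then have "rat_value (2 - f - 1 / path_b f q) x (2 - \<nu> - 1 / path_b \<nu> q)"
    by (intro rat_value_diff rat_value_2 rat_value_inverse assms(1)) auto
  then show ?case
    using \<open>0 < q\<close> by (cases q) auto
qed

lemma rat_value_drift:
  assumes f: "rat_value f x \<nu>" and T: "starlike_tree T" and neg: "legs_neg T \<nu>"
  shows "rat_value (drift T f) x (drift T \<nu>)"
proof -
  have "rat_value (\<Sum>q\<leftarrow>qs. 1 - 1 / path_b f q) x (\<Sum>q\<leftarrow>qs. 1 - 1 / path_b \<nu> q)"
    if "set qs \<subseteq> set (legs T)" for qs
    using that
  proof (induction qs)
    case Nil
    show ?case
      using rat_value_diff[OF rat_value_1 rat_value_1] by simp
  next
    case (Cons q qs)
    then have q: "q \<in> set (legs T)"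
      by simp
    then have nz: "path_b \<nu> i \<noteq> 0" if "0 < i" "i \<le> q" for i
      using neg that unfolding legs_neg_def by (metis less_irrefl)
    have "rat_value (path_b f q) x (path_b \<nu> q)"
      using legs_pos[OF T q] nz by (intro rat_value_path_b f) simp_all
    then have "rat_value (1 - 1 / path_b f q) x (1 - 1 / path_b \<nu> q)"
      using legs_pos[OF T q] nz by (intro rat_value_diff rat_value_1 rat_value_inverse) simp_all
    with Cons show ?case
      by (simp add: rat_value_add)
  qed
  then show ?thesis
    by (simp add: drift_def)
qed

lemma rat_value_S_inner:
  assumes f: "rat_value f x \<nu>" and T: "\<And>j. 1 \<le> j \<Longrightarrow> starlike_tree (T j)" and "0 < k"
    and "\<And>j. 1 \<le> j \<Longrightarrow> j < k \<Longrightarrow> S_inner T \<nu> j < 0"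
    and "\<And>j. 1 \<le> j \<Longrightarrow> j \<le> k \<Longrightarrow> legs_neg (T j) \<nu>"
  shows "rat_value (S_inner T f k) x (S_inner T \<nu> k)"
  using assms(3-)
proof (induction k rule: nat_induct_non_zero)
  case 1
  then show ?case
    using rat_value_add[OF rat_value_diff[OF rat_value_1 f] rat_value_drift[OF f T[of 1]]] by simp
next
  case (Suc k)
  have "S_inner T \<nu> k \<noteq> 0"
    using Suc.prems(1)[of k] Suc.hyps by simp
  with Suc have "rat_value (2 - f - 1 / S_inner T f k + drift (T (Suc k)) f) x
      (2 - \<nu> - 1 / S_inner T \<nu> k + drift (T (Suc k)) \<nu>)"
    by (intro rat_value_add rat_value_diff rat_value_2 rat_value_inverse rat_value_drift f T) auto
  then show ?case
    using \<open>0 < k\<close> by (cases k) (auto simp: psi_def)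
qed

text \<open>Every divisor in the recursion is negative at \<mu> - \<epsilon>, so evaluation at
  \<epsilon> commutes with it.\<close>

lemma rat_value_S_rat:
  assumes T: "\<And>j. 1 \<le> j \<Longrightarrow> starlike_tree (T j)" and C: "starlike_tree (C k)" and k: "2 \<le> k"
    and "legs_neg (C k) (\<mu> - \<epsilon>)"
    and "\<And>j. 1 \<le> j \<Longrightarrow> j < k \<Longrightarrow> S_inner T (\<mu> - \<epsilon>) j < 0 \<and> legs_neg (T j) (\<mu> - \<epsilon>)"
  shows "rat_value (S_rat T C \<mu> k) \<epsilon> (S_last T C (\<mu> - \<epsilon>) k)"
proof -
  have f: "rat_value (Fract [:\<mu>, - 1:] 1) \<epsilon> (\<mu> - \<epsilon>)"
    using rat_value_Fract[of 1 \<epsilon> "[:\<mu>, - 1:]"] by simp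
  have "S_inner T (\<mu> - \<epsilon>) (k - 1) \<noteq> 0"
    using assms(5)[of "k - 1"] k by force
  moreover have "rat_value (S_inner T (Fract [:\<mu>, - 1:] 1) (k - 1)) \<epsilon> (S_inner T (\<mu> - \<epsilon>) (k - 1))"
    using k assms(5) by (intro rat_value_S_inner f T) auto
  ultimately show ?thesis
    unfolding S_rat_def S_last_def psi_def
    by (intro rat_value_add rat_value_diff rat_value_uminus rat_value_1 rat_value_2
        rat_value_inverse rat_value_drift f C assms(4))
qed

section \<open>The smallest positive zero is \<open>\<mu> - \<rho>\<^sub>L(G\<^sub>k)\<close>\<close>

lemma rho_L_shearer_graph:
  assumes T: "\<And>j. 1 \<le> j \<Longrightarrow> starlike_tree (T j)" and C: "starlike_tree (C k)" and k: "2 \<le> k"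
    and zero: "S_last T C \<nu> k = 0" and C_neg: "legs_neg (C k) \<nu>"
    and neg: "\<And>j. 1 \<le> j \<Longrightarrow> j < k \<Longrightarrow> S_inner T \<nu> j < 0 \<and> legs_neg (T j) \<nu>"
  shows "rho_L (shearer_graph T C k) = \<nu>"
proof -
  let ?Ts = "map T [1..<k] @ [C k]"
  \<comment> \<open>Shift from the 0-based spine to the 1-based sequence: \<open>a j\<close> is the
    entry with index \<open>j + 1\<close>, the last one being \<open>S_last\<close>.\<close>
  define a where "a j = (if Suc j < k then S_inner T \<nu> (Suc j) else S_last T C \<nu> k)" for j
  have len: "length ?Ts = k"
    using k by simp
  have nth: "?Ts ! j = T (Suc j)" if "Suc j < k" for j
  proof -
    from that have "j < k - 1"
      by simp
    then show ?thesis
      by (simp add: nth_append)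
  qed
  have nth_last: "?Ts ! (k - 1) = C k"
    using k by (simp add: nth_append)
  have "rho_L (linear_tree ?Ts) = \<nu>"
  proof (rule rho_L_linear_tree_eqI[where a = a])
    show "starlike_tree S" if "S \<in> set ?Ts" for S
      using that T C by auto
    show "a j = (if j = 0 then 0 else 1 - 1 / a (j - 1)) +
        (if Suc j < length ?Ts then 1 else 0) - \<nu> + drift (?Ts ! j) \<nu>" if "j < length ?Ts" for j
    proof (cases "Suc j < k")
      case True
      then show ?thesis
        unfolding len nth[OF True] by (cases j) (auto simp: a_def psi_def)
    next
      case False
      with that have "Suc j = k"
        by (simp only: len)
      with k obtain m where "j = Suc m" "k = Suc (Suc m)"
        by (cases j) auto
      then show ?thesis
        unfolding len using nth_last by (auto simp: a_def psi_def S_last_def)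
    qed
    show "a j < 0" if "Suc j < length ?Ts" for j
      using that neg[of "Suc j"] unfolding len by (simp add: a_def)
    show "a (length ?Ts - 1) = 0"
      unfolding len using zero k by (simp add: a_def)
    show "path_b \<nu> i < 0" if "S \<in> set ?Ts" "q \<in> set (legs S)" "0 < i" "i \<le> q" for S q i
    proof -
      have "legs_neg S \<nu>"
        using that(1) C_neg neg by auto
      with that(2-) show ?thesis
        by (auto simp: legs_neg_def)
    qed
  qed simp
  then show ?thesis
    using k by (simp add: shearer_graph_def)
qed

text \<open>Under \<nu> = \<mu> - \<epsilon> the smallest positive \<epsilon> corresponds to the
  largest zero, and the strict inequality \<open>less\<close> makes this \<epsilon>
  positive.\<close>

lemma eps_eq:
  assumes T: "\<And>j. 1 \<le> j \<Longrightarrow> starlike_tree (T j)" and C: "starlike_tree (C k)" and k: "2 \<le> k"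
    and less: "rho_L (shearer_graph T C k) < \<mu>"
  shows "eps T C \<mu> k = \<mu> - rho_L (shearer_graph T C k)"
proof -
  obtain t where t: "top_zero (\<lambda>\<nu>. S_last T C \<nu> k) t"
      "\<And>\<nu>. t \<le> \<nu> \<Longrightarrow> legs_neg (C k) \<nu>"
      "\<And>\<nu> j. t \<le> \<nu> \<Longrightarrow> 1 \<le> j \<Longrightarrow> j < k \<Longrightarrow> S_inner T \<nu> j < 0 \<and> legs_neg (T j) \<nu>"
    using top_zero_S_last[of T C k] T C k by blast
  have rho: "rho_L (shearer_graph T C k) = t"
    using t by (intro rho_L_shearer_graph T C k) (auto simp: top_zero_def)
  \<comment> \<open>From \<open>t\<close> on there are no poles, so the rational function and the
    real one have the same zeros; this range contains every \<epsilon> that could be smaller than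
    \<open>\<mu> - t\<close>.\<close>
  have zero_iff: "rat_zero (S_rat T C \<mu> k) \<epsilon> \<longleftrightarrow> S_last T C (\<mu> - \<epsilon>) k = 0" if "t \<le> \<mu> - \<epsilon>" for \<epsilon>
    using t(2,3)[OF that] by (intro rat_zero_iff rat_value_S_rat T C k) auto
  have "eps T C \<mu> k = \<mu> - t"
    unfolding eps_def
  proof (rule Least_equality)
    show "0 < \<mu> - t \<and> rat_zero (S_rat T C \<mu> k) (\<mu> - t)"
      using less rho zero_iff[of "\<mu> - t"] t(1) by (simp add: top_zero_def)
    fix \<epsilon> assume \<epsilon>: "0 < \<epsilon> \<and> rat_zero (S_rat T C \<mu> k) \<epsilon>"
    show "\<mu> - t \<le> \<epsilon>"
      using zero_iff[of \<epsilon>] top_zero_neg[OF t(1), of "\<mu> - \<epsilon>"] \<epsilon> by force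
  qed
  with rho show ?thesis
    by simp
qed

section \<open>Passage to the limit\<close>

theorem theorem7p1:
  fixes \<mu> :: real and T C :: "nat \<Rightarrow> nat list"
  assumes "mu_min \<le> \<mu>"
    and "generalized_shearer T C"
    and "dominated_by T C \<mu>"
  shows "(\<lambda>k. rho_L (shearer_graph T C k)) \<longlonglongrightarrow> \<mu> \<longleftrightarrow> (\<lambda>k. eps T C \<mu> k) \<longlonglongrightarrow> 0"
proof -
  define \<rho> where "\<rho> k = rho_L (shearer_graph T C k)" for k
  obtain B where T: "\<And>j. 1 \<le> j \<Longrightarrow> starlike_tree (T j)" "\<And>j. 1 \<le> j \<Longrightarrow> width (T j) \<le> B"
    and C: "\<And>j. 2 \<le> j \<Longrightarrow> starlike_tree (C j)" "\<And>j. 2 \<le> j \<Longrightarrow> width (C j) \<le> B"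
    and mono: "\<And>k. 1 \<le> k \<Longrightarrow> \<rho> k < \<rho> (Suc k)"
    using assms(2) unfolding generalized_shearer_def \<rho>_def by blast
  have bound: "\<rho> (Suc k) \<le> 2 * real B + 4" for k
    unfolding \<rho>_def shearer_graph_def using T C
    by (auto intro!: rho_L_linear_tree_le simp del: upt_Suc)
  have strict: "\<rho> (Suc k) < \<rho> (Suc (Suc k))" for k
    using mono by simp
  then have inc: "incseq (\<lambda>k. \<rho> (Suc k))"
    by (intro incseq_SucI less_imp_le)
  then obtain L where L: "(\<lambda>k. \<rho> (Suc k)) \<longlonglongrightarrow> L" "\<And>k. \<rho> (Suc k) \<le> L"
    using incseq_convergent[of "\<lambda>k. \<rho> (Suc k)"] bound by metis
  from L(1) have "\<rho> \<longlonglongrightarrow> L"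
    by (simp only: filterlim_sequentially_Suc)
  \<comment> \<open>Convergence is established first, so the \<open>lim\<close> in
    \<open>dominated_by\<close> is the actual limit.\<close>
  then have "L \<le> \<mu>"
    using assms(3) by (simp add: dominated_by_def limI \<rho>_def[symmetric])
  \<comment> \<open>Strict growth keeps every term below \<open>L\<close>, hence below \<mu> even if
    \<open>L = \<mu>\<close>.\<close>
  then have less: "\<rho> (Suc k) < \<mu>" for k
    using strict[of k] L(2)[of "Suc k"] by linarith
  have "eps T C \<mu> k = \<mu> - \<rho> k" if "2 \<le> k" for k
    using eps_eq[of T C k \<mu>] T(1) C(1)[OF that] that less[of "k - 1"] by (simp add: \<rho>_def)
  then have "\<forall>\<^sub>F k in sequentially. eps T C \<mu> k = \<mu> - \<rho> k"
    by (rule eventually_sequentiallyI)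
  then have "(\<lambda>k. eps T C \<mu> k) \<longlonglongrightarrow> 0 \<longleftrightarrow> (\<lambda>k. \<mu> - \<rho> k) \<longlonglongrightarrow> 0"
    by (rule tendsto_cong)
  also have "\<dots> \<longleftrightarrow> \<rho> \<longlonglongrightarrow> \<mu>"
    using tendsto_diff[of "\<lambda>_. \<mu>" \<mu> sequentially "\<lambda>k. \<mu> - \<rho> k" 0]
      tendsto_diff[of "\<lambda>_. \<mu>" \<mu> sequentially \<rho> \<mu>] by auto
  finally show ?thesis
    by (simp add: \<rho>_def[abs_def])
qed

end
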